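(* Let $n\ge 3$ and let $C_1,\dots,C_n$ be events in a probability space. For every ordering (permutation) $\pi$ of $\{1,\dots,n\}$, the level 2 bound is less than or equal to the level 1 bound: $B_2(\pi)\le B_1(\pi)$.
   Context: For a permutation $\pi$ of $\{1,\dots,n\}$ put $P_i=P[C_{\pi(i)}]$ and $P_{ij}=P_{ji}=P[C_{\pi(i)}\cap C_{\pi(j)}]$ (so these depend on $\pi$), and $[x]^+=\max(x,0)$. The level 1 and level 2 bounds in the ordering $\pi$ are $$B_1(\pi)=P_1+P_2-P_{12}+\sum_{i=3}^n\Big[P_i-\max_{1\le j<i}P_{ji}\Big],$$ $$B_2(\pi)=P_1+P_2-P_{12}+\sum_{i=3}^n\Big[P_i-\max_{1\le j<l<i}\big\{P_{ji}+P_{li}-\min(P_{ji},P_{li},P_{lj})\big\}\Big]^+.$$ *)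

theory Defs
  imports "HOL-Probability.Probability"
begin

definition evt_prob :: "'a measure \<Rightarrow> (nat \<Rightarrow> 'a set) \<Rightarrow> (nat \<Rightarrow> nat) \<Rightarrow> nat \<Rightarrow> real" where
  "evt_prob M C \<pi> i = measure M (C (\<pi> i))"

definition pair_prob :: "'a measure \<Rightarrow> (nat \<Rightarrow> 'a set) \<Rightarrow> (nat \<Rightarrow> nat) \<Rightarrow> nat \<Rightarrow> nat \<Rightarrow> real" where
  "pair_prob M C \<pi> i j = measure M (C (\<pi> i) \<inter> C (\<pi> j))"

definition pos_part :: "real \<Rightarrow> real" where
  "pos_part x = max x 0"

text \<open>In both bounds the outer sum starts at \<open>i = 3\<close>, so every \<open>Max\<close> below is taken over a
  finite nonempty set.\<close>

definition level1_bound :: "'a measure \<Rightarrow> (nat \<Rightarrow> 'a set) \<Rightarrow> nat \<Rightarrow> (nat \<Rightarrow> nat) \<Rightarrow> real" where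
  "level1_bound M C n \<pi> =
     evt_prob M C \<pi> 1 + evt_prob M C \<pi> 2 - pair_prob M C \<pi> 1 2 +
     (\<Sum>i=3..n. evt_prob M C \<pi> i - Max {pair_prob M C \<pi> j i | j. 1 \<le> j \<and> j < i})"

definition level2_bound :: "'a measure \<Rightarrow> (nat \<Rightarrow> 'a set) \<Rightarrow> nat \<Rightarrow> (nat \<Rightarrow> nat) \<Rightarrow> real" where
  "level2_bound M C n \<pi> =
     evt_prob M C \<pi> 1 + evt_prob M C \<pi> 2 - pair_prob M C \<pi> 1 2 +
     (\<Sum>i=3..n. pos_part (evt_prob M C \<pi> i -
        Max {pair_prob M C \<pi> j i + pair_prob M C \<pi> l i -
               min (pair_prob M C \<pi> j i) (min (pair_prob M C \<pi> l i) (pair_prob M C \<pi> l j))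
             | j l. 1 \<le> j \<and> j < l \<and> l < i}))"

end

theory Submission
  imports Defs
begin

text \<open>The inequality holds term by term. Since
  \<open>a + b - min a (min b c) \<ge> max a b\<close>, completing a maximising index \<open>j\<close> of the level 1 term
  by any further index below \<open>i\<close> shows that the level 2 maximum is at least the level 1 maximum;
  and truncating at \<open>0\<close> does no harm because \<open>P\<^sub>j\<^sub>i \<le> P\<^sub>i\<close> makes the level 1 term
  nonnegative.\<close>

lemma (in finite_measure) pair_prob_le_evt_prob:
  assumes "C (\<pi> i) \<in> sets M"
  shows "pair_prob M C \<pi> j i \<le> evt_prob M C \<pi> i"
  using assms unfolding pair_prob_def evt_prob_def by (intro finite_measure_mono) auto

text \<open>Whatever the value of \<open>q l j\<close>, the subtracted minimum is at most
  \<open>p j\<close> and at most \<open>p l\<close>, so \<open>q\<close> can be kept as a free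
  function.\<close>

lemma Max_le_Max_pair_union:
  fixes p :: "nat \<Rightarrow> real" and q :: "nat \<Rightarrow> nat \<Rightarrow> real"
  assumes "3 \<le> i"
  shows "Max {p j | j. 1 \<le> j \<and> j < i}
    \<le> Max {p j + p l - min (p j) (min (p l) (q l j)) | j l. 1 \<le> j \<and> j < l \<and> l < i}"
    (is "Max ?A \<le> Max ?B")
proof -
  have B: "?B = (\<lambda>(j, l). p j + p l - min (p j) (min (p l) (q l j))) `
      {(j, l). 1 \<le> j \<and> j < l \<and> l < i}"
    by auto
  have "finite {(j, l). 1 \<le> j \<and> j < l \<and> l < i}"
    by (rule finite_subset[of _ "{..<i} \<times> {..<i}"]) auto
  then have finB: "finite ?B"
    unfolding B by (rule finite_imageI)
  have pair: "p j \<le> Max ?B \<and> p l \<le> Max ?B" if "1 \<le> j" "j < l" "l < i" for j l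
  proof -
    have "p j + p l - min (p j) (min (p l) (q l j)) \<le> Max ?B"
      using that finB by (intro Max_ge) auto
    then show ?thesis by linarith
  qed
  have "p j \<le> Max ?B" if "1 \<le> j" "j < i" for j
  \<comment> \<open>Pairs in \<open>?B\<close> are ordered, so \<open>j\<close> becomes the larger
    entry with partner 1. Only \<open>j = 1\<close> needs another partner: 2, which is below
    \<open>i\<close> since \<open>3 \<le> i\<close>.\<close>
  proof (cases "j = 1")
    case True
    then show ?thesis using pair[of 1 2] assms by simp
  next
    case False
    then show ?thesis using pair[of 1 j] that by simp
  qed
  \<comment> \<open>A witness that \<open>?A\<close> is nonempty, as \<open>Max_le_iff\<close>
    requires.\<close>
  moreover have "p 1 \<in> ?A" using assms by auto
  ultimately show ?thesis by (subst Max_le_iff) auto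
qed

theorem theorem1:
  fixes M :: "'a measure" and C :: "nat \<Rightarrow> 'a set" and n :: nat and \<pi> :: "nat \<Rightarrow> nat"
  assumes "prob_space M"
    and "3 \<le> n"
    and "\<And>i. i \<in> {1..n} \<Longrightarrow> C i \<in> sets M"
    and "\<pi> permutes {1..n}"
  shows "level2_bound M C n \<pi> \<le> level1_bound M C n \<pi>"
proof -
  interpret prob_space M by fact
  have "pos_part (evt_prob M C \<pi> i -
        Max {pair_prob M C \<pi> j i + pair_prob M C \<pi> l i -
               min (pair_prob M C \<pi> j i) (min (pair_prob M C \<pi> l i) (pair_prob M C \<pi> l j))
             | j l. 1 \<le> j \<and> j < l \<and> l < i})
      \<le> evt_prob M C \<pi> i - Max {pair_prob M C \<pi> j i | j. 1 \<le> j \<and> j < i}"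
    (is "pos_part (_ - ?B) \<le> _ - Max ?A") if i: "i \<in> {3..n}" for i
  proof -
    have "C (\<pi> i) \<in> sets M"
      using i assms(3) permutes_in_image[OF assms(4), of i] by simp
    moreover have "pair_prob M C \<pi> 1 i \<in> ?A" using i by auto
    ultimately have "Max ?A \<le> evt_prob M C \<pi> i"
      by (subst Max_le_iff) (auto intro: pair_prob_le_evt_prob)
    moreover have "Max ?A \<le> ?B"
      using i by (intro Max_le_Max_pair_union) simp
    \<comment> \<open>The first bound on \<open>Max ?A\<close> settles the case where the positive
      part is 0, the second the case where it is the difference itself.\<close>
    ultimately show ?thesis by (simp add: pos_part_def)
  qed
  then show ?thesis
    unfolding level1_bound_def level2_bound_def by (intro add_left_mono sum_mono)
qed

end
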